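(* Suppose the sequence $(a_n)_{n\ge1}$ of non-negative real numbers is unbounded and $a_n - a_{n-1} \to 0$ as $n\to\infty$. Then the associated Rademacher random walk is either transient or topologically recurrent.
   Context: Let $\epsilon_1, \epsilon_2, \dots$ be independent Rademacher random variables, taking values $\pm 1$ each with probability $1/2$. The Rademacher random walk associated with a deterministic sequence $(a_n)_{n\ge1}$ of non-negative reals is $(X_n)_{n\ge 0}$, $X_n = \sum_{k=1}^n \epsilon_k a_k$. The walk is weakly recurrent if $\mathbb{P}(\exists C<\infty : |X_n| \le C \text{ for infinitely many } n) = 1$; otherwise it is called transient (the event is a tail event, so by Kolmogorov's zero-one law transience means its probability is $0$). The walk is topologically recurrent if its range $\{X_n : n \ge 0\}$ is almost surely dense in $\mathbb{R}$. *)

theory Defs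
  imports "HOL-Probability.Probability"
begin

text \<open>Coefficients and signs are indexed from 1: their values at index 0 are immaterial.\<close>

definition rademacher_sequence :: "'w measure \<Rightarrow> (nat \<Rightarrow> 'w \<Rightarrow> real) \<Rightarrow> bool" where
  "rademacher_sequence M \<epsilon> \<longleftrightarrow>
     prob_space.indep_vars M (\<lambda>_. borel) \<epsilon> {1..} \<and>
     (\<forall>n\<ge>1. measure M {w \<in> space M. \<epsilon> n w = 1} = 1 / 2 \<and>
            measure M {w \<in> space M. \<epsilon> n w = -1} = 1 / 2)"

definition rademacher_walk ::
    "(nat \<Rightarrow> 'w \<Rightarrow> real) \<Rightarrow> (nat \<Rightarrow> real) \<Rightarrow> nat \<Rightarrow> 'w \<Rightarrow> real" where
  "rademacher_walk \<epsilon> a n w = (\<Sum>k=1..n. \<epsilon> k w * a k)"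

definition weakly_recurrent :: "'w measure \<Rightarrow> (nat \<Rightarrow> 'w \<Rightarrow> real) \<Rightarrow> bool" where
  "weakly_recurrent M X \<longleftrightarrow>
     measure M {w \<in> space M. \<exists>C. \<exists>\<^sub>\<infinity>n. \<bar>X n w\<bar> \<le> C} = 1"

definition transient :: "'w measure \<Rightarrow> (nat \<Rightarrow> 'w \<Rightarrow> real) \<Rightarrow> bool" where
  "transient M X \<longleftrightarrow> \<not> weakly_recurrent M X"

definition topologically_recurrent :: "'w measure \<Rightarrow> (nat \<Rightarrow> 'w \<Rightarrow> real) \<Rightarrow> bool" where
  "topologically_recurrent M X \<longleftrightarrow>
     (AE w in M. closure (range (\<lambda>n. X n w)) = UNIV)"

end

theory Submission
  imports Defs
begin

text \<open>
  The sign sequence has the same law after the signs in a fixed set of indices are reversed. By the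
  argument of the Hewitt--Savage zero-one law, any event determined by the whole sequence is almost
  unaffected by such a reversal when the indices avoid a suitable finite set, because the event is
  nearly determined by finitely many signs (\<open>almost_invariant_under_remote_flips\<close>).

  If \<open>\<epsilon>\<^sub>i = 1\<close> and \<open>\<epsilon>\<^sub>j = -1\<close>, reversing both signs translates the walk by
  \<open>2 (a\<^sub>j - a\<^sub>i)\<close> from some time on. Since the coefficients are unbounded and have increments
  tending to \<open>0\<close>, these differences approximate every real number, however large \<open>i\<close> and \<open>j\<close>
  are required to be (\<open>remote_differences_dense\<close>). So consider the event that the walk visits the
  \<open>r\<close>-neighbourhood of \<open>c\<close> infinitely often, but the \<open>2r\<close>-neighbourhood of \<open>q\<close> only finitely often.
  Choosing \<open>2 (a\<^sub>j - a\<^sub>i)\<close> close to \<open>q - c\<close>, one always leaves this event by reversing some of the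
  signs \<open>\<epsilon>\<^sub>i, \<epsilon>\<^sub>j\<close>. There are only four ways of doing so, each of which leaves the event with
  arbitrarily small probability; hence the event is null (\<open>often_near_transfer\<close>).

  Discarding countably many null events, we may use this for all rational \<open>c\<close>, \<open>q\<close> and
  \<open>r\<close> at once. A walk that is bounded along a subsequence accumulates somewhere, so it is
  infinitely often near some rational \<open>c\<close>, and therefore near every rational \<open>q\<close>.
\<close>

section \<open>Reversing signs far out\<close>

definition flip :: "'i set \<Rightarrow> ('i \<Rightarrow> real) \<Rightarrow> 'i \<Rightarrow> real" where
  "flip F x = (\<lambda>k. if k \<in> F then - x k else x k)"

lemma flip_measurable:
  assumes "F \<subseteq> I"
  shows "flip F \<in> measurable (PiM I (\<lambda>_. borel)) (PiM I (\<lambda>_. borel))"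
proof (rule measurable_PiM_single')
  fix k assume k: "k \<in> I"
  have "(\<lambda>x. flip F x k) = (\<lambda>x. (if k \<in> F then -1 else 1) * x k)"
    by (auto simp: flip_def)
  also have "\<dots> \<in> borel_measurable (PiM I (\<lambda>_. borel))"
    by (intro borel_measurable_times borel_measurable_const measurable_component_singleton k)
  finally show "(\<lambda>x. flip F x k) \<in> borel_measurable (PiM I (\<lambda>_. borel))" .
next
  show "flip F \<in> space (PiM I (\<lambda>_. borel)) \<rightarrow> (\<Pi>\<^sub>E k\<in>I. space borel)"
    using assms by (auto simp: flip_def space_PiM PiE_def extensional_def subset_iff)
qed

text \<open>
  The sign reversals act on values of the process, not on the sample space. Invariance is therefore
  expressed through the law of the whole family in the product space \<open>PiM I borel\<close>.
\<close>

locale symmetric_family = prob_space M for M :: "'w measure" +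
  fixes I :: "'i set" and \<epsilon> :: "'i \<Rightarrow> 'w \<Rightarrow> real"
  assumes nonempty: "I \<noteq> {}"
    and indep: "indep_vars (\<lambda>_. borel) \<epsilon> I"
    and symmetric: "k \<in> I \<Longrightarrow> distr M borel (\<lambda>w. - \<epsilon> k w) = distr M borel (\<epsilon> k)"
begin

definition signs :: "'w \<Rightarrow> 'i \<Rightarrow> real" where
  "signs w = (\<lambda>k\<in>I. \<epsilon> k w)"

lemma component_measurable: "k \<in> I \<Longrightarrow> \<epsilon> k \<in> borel_measurable M"
  using indep by (auto simp: indep_vars_def)

lemma signs_component: "k \<in> I \<Longrightarrow> signs w k = \<epsilon> k w"
  by (simp add: signs_def)

lemma signs_measurable [measurable]: "signs \<in> measurable M (PiM I (\<lambda>_. borel))"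
  unfolding signs_def using component_measurable by measurable

lemma signs_in: "signs w \<in> (\<Pi>\<^sub>E k\<in>I. UNIV)"
  by (auto simp: signs_def)

lemma flip_signs_in: "F \<subseteq> I \<Longrightarrow> flip F (signs w) \<in> (\<Pi>\<^sub>E k\<in>I. UNIV)"
  by (auto simp: signs_def flip_def PiE_def extensional_def)

text \<open>
  Reversed signs are again independent and have the same marginals, and these determine the law.
\<close>

lemma distr_flip_signs:
  assumes "F \<subseteq> I"
  shows "distr M (PiM I (\<lambda>_. borel)) (\<lambda>w. flip F (signs w)) = distr M (PiM I (\<lambda>_. borel)) signs"
proof -
  let ?\<delta> = "\<lambda>k w. if k \<in> F then - \<epsilon> k w else \<epsilon> k w"
  have m: "\<And>k. k \<in> I \<Longrightarrow> ?\<delta> k \<in> borel_measurable M"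
    using component_measurable by (auto intro: borel_measurable_uminus)
  have "indep_vars (\<lambda>_. borel) (\<lambda>k. (\<lambda>x. if k \<in> F then - x else x) \<circ> \<epsilon> k) I"
    by (rule indep_vars_compose[OF indep]) simp
  then have i: "indep_vars (\<lambda>_. borel) ?\<delta> I"
    by (simp add: comp_def)
  have "flip F (signs w) = (\<lambda>k\<in>I. ?\<delta> k w)" for w
    using assms by (auto simp: flip_def signs_def fun_eq_iff)
  then have "distr M (PiM I (\<lambda>_. borel)) (\<lambda>w. flip F (signs w)) =
      PiM I (\<lambda>k. distr M borel (?\<delta> k))"
    using indep_vars_iff_distr_eq_PiM'[OF nonempty m] i by simp
  also have "\<dots> = PiM I (\<lambda>k. distr M borel (\<epsilon> k))"
  proof (intro PiM_cong refl)
    fix k assume "k \<in> I"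
    then show "distr M borel (?\<delta> k) = distr M borel (\<epsilon> k)"
      using symmetric[of k] by (cases "k \<in> F") simp_all
  qed
  also have "\<dots> = distr M (PiM I (\<lambda>_. borel)) signs"
    using indep_vars_iff_distr_eq_PiM'[OF nonempty component_measurable] indep
    by (simp add: signs_def[abs_def])
  finally show ?thesis .
qed

lemma prob_flip_signs:
  assumes "F \<subseteq> I" and A: "A \<in> sets (PiM I (\<lambda>_. borel))"
  shows "prob {w \<in> space M. flip F (signs w) \<in> A} = prob {w \<in> space M. signs w \<in> A}"
proof -
  note [measurable] = flip_measurable[OF assms(1)]
  have "measure (distr M (PiM I (\<lambda>_. borel)) (\<lambda>w. flip F (signs w))) A
      = prob {w \<in> space M. flip F (signs w) \<in> A}"
    by (subst measure_distr) (use A in \<open>auto intro!: arg_cong[of _ _ prob]\<close>)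
  moreover have "measure (distr M (PiM I (\<lambda>_. borel)) signs) A = prob {w \<in> space M. signs w \<in> A}"
    by (subst measure_distr) (use A in \<open>auto intro!: arg_cong[of _ _ prob]\<close>)
  ultimately show ?thesis
    using distr_flip_signs[OF assms(1)] by simp
qed

text \<open>
  An event that depends on one coordinate is not affected by reversals elsewhere, and the asserted
  property passes to complements and countable unions, hence to the generated \<open>\<sigma>\<close>-algebra. For a
  union, all but finitely many members can be neglected: what they add has small probability, both
  before and after the reversal, because the law is the same.
\<close>

lemma almost_invariant_under_remote_flips:
  assumes "A \<in> sets (PiM I (\<lambda>_. borel))" and "\<eta> > 0"
  shows "\<exists>J. finite J \<and> (\<forall>F \<subseteq> I - J.
    prob {w \<in> space M. (signs w \<in> A) \<noteq> (flip F (signs w) \<in> A)} < \<eta>)"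
  using assms(1)[unfolded sets_PiM_single] assms(2)
proof (induction arbitrary: \<eta> rule: sigma_sets.induct)
  case (Basic A)
  then obtain k S where A: "A = {x \<in> \<Pi>\<^sub>E k\<in>I. space borel. x k \<in> S}" by auto
  have "(signs w \<in> A) = (flip F (signs w) \<in> A)" if "F \<subseteq> I - {k}" for F w
    using that signs_in[of w] flip_signs_in[of F w] unfolding A by (auto simp: flip_def)
  then show ?case using Basic.prems by (intro exI[of _ "{k}"]) simp
next
  case Empty
  then show ?case by auto
next
  case (Compl A)
  obtain J where "finite J"
    and "\<forall>F \<subseteq> I - J. prob {w \<in> space M. (signs w \<in> A) \<noteq> (flip F (signs w) \<in> A)} < \<eta>"
    using Compl.IH[OF Compl.prems] by blast
  moreover have "((signs w \<in> (\<Pi>\<^sub>E k\<in>I. space borel) - A) \<noteq> (flip F (signs w) \<in> (\<Pi>\<^sub>E k\<in>I. space borel) - A))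
      = ((signs w \<in> A) \<noteq> (flip F (signs w) \<in> A))" if "F \<subseteq> I - J" for F w
    using that signs_in[of w] flip_signs_in[of F w] by auto
  ultimately show ?case by (intro exI[of _ J]) simp
next
  case (Union A)
  have A [measurable]: "A k \<in> sets (PiM I (\<lambda>_. borel))" for k
    using Union.hyps by (simp add: sets_PiM_single)
  \<comment> \<open>the part of the union that its first \<open>K\<close> members miss\<close>
  define R where "R K = (\<Union>k. A k) - (\<Union>k<K. A k)" for K :: nat
  have R [measurable]: "R K \<in> sets (PiM I (\<lambda>_. borel))" for K
    unfolding R_def by measurable
  have "(\<lambda>K. prob {w \<in> space M. signs w \<in> R K}) \<longlonglongrightarrow> prob (\<Inter>K. {w \<in> space M. signs w \<in> R K})"
    by (rule finite_Lim_measure_decseq) (auto simp: decseq_def R_def)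
  moreover have "(\<Inter>K. {w \<in> space M. signs w \<in> R K}) = {}"
    by (auto simp: R_def)
  ultimately have "\<forall>\<^sub>F K in sequentially. prob {w \<in> space M. signs w \<in> R K} < \<eta> / 4"
    using Union.prems by (intro order_tendstoD(2)) auto
  then obtain K where K: "prob {w \<in> space M. signs w \<in> R K} < \<eta> / 4"
    by (auto simp: eventually_sequentially)
  \<comment> \<open>\<open>K\<close> members with error \<open>\<theta>\<close> each use a quarter of \<open>\<eta>\<close>; the two remainders use less than half\<close>
  define \<theta> where "\<theta> = \<eta> / (4 * (real K + 1))"
  have "\<theta> > 0" using Union.prems by (simp add: \<theta>_def)
  from Union.IH[OF this] have "\<forall>k. \<exists>J. finite J \<and> (\<forall>F \<subseteq> I - J.
      prob {w \<in> space M. (signs w \<in> A k) \<noteq> (flip F (signs w) \<in> A k)} < \<theta>)"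
    by (rule allI)
  from choice[OF this] obtain J where J: "\<And>k. finite (J k)"
    "\<And>k F. F \<subseteq> I - J k \<Longrightarrow> prob {w \<in> space M. (signs w \<in> A k) \<noteq> (flip F (signs w) \<in> A k)} < \<theta>"
    by blast
  have "prob {w \<in> space M. (signs w \<in> (\<Union>k. A k)) \<noteq> (flip F (signs w) \<in> (\<Union>k. A k))} < \<eta>"
    if F: "F \<subseteq> I - (\<Union>k<K. J k)" for F
  proof -
    have FI: "F \<subseteq> I" using F by auto
    note [measurable] = flip_measurable[OF FI]
    let ?D = "\<lambda>k. {w \<in> space M. (signs w \<in> A k) \<noteq> (flip F (signs w) \<in> A k)}"
    let ?R = "{w \<in> space M. signs w \<in> R K}" and ?R' = "{w \<in> space M. flip F (signs w) \<in> R K}"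
    have D_event: "?D k \<in> events" for k by measurable
    have R_event: "?R \<in> events" "?R' \<in> events" by measurable
    have UD_event: "(\<Union>k<K. ?D k) \<in> events" using D_event by (intro sets.finite_UN) auto
    have "prob (\<Union>k<K. ?D k) \<le> (\<Sum>k<K. prob (?D k))"
      using D_event by (intro finite_measure_subadditive_finite) auto
    also have "\<dots> \<le> (\<Sum>k<K. \<theta>)"
    proof (rule sum_mono)
      fix k assume "k \<in> {..<K}"
      then have "F \<subseteq> I - J k" using F by blast
      from J(2)[OF this] show "prob (?D k) \<le> \<theta>" by (rule less_imp_le)
    qed
    also have "\<dots> \<le> \<eta> / 4"
      using Union.prems by (simp add: \<theta>_def field_simps)
    finally have D: "prob (\<Union>k<K. ?D k) \<le> \<eta> / 4" .
    have "{w \<in> space M. (signs w \<in> (\<Union>k. A k)) \<noteq> (flip F (signs w) \<in> (\<Union>k. A k))}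
        \<subseteq> ?R \<union> ?R' \<union> (\<Union>k<K. ?D k)"
      unfolding R_def by blast
    then have "prob {w \<in> space M. (signs w \<in> (\<Union>k. A k)) \<noteq> (flip F (signs w) \<in> (\<Union>k. A k))}
        \<le> prob (?R \<union> ?R' \<union> (\<Union>k<K. ?D k))"
      by (rule finite_measure_mono) (intro sets.Un R_event UD_event)
    also have "\<dots> \<le> prob (?R \<union> ?R') + prob (\<Union>k<K. ?D k)"
      by (intro measure_Un_le sets.Un R_event UD_event)
    also have "prob (?R \<union> ?R') \<le> prob ?R + prob ?R'"
      by (intro measure_Un_le R_event)
    also have "prob ?R' = prob ?R"
      by (rule prob_flip_signs[OF FI R])
    finally show ?thesis using K D Union.prems by simp
  qed
  then show ?case using J(1) by (intro exI[of _ "\<Union>k<K. J k"]) auto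
qed

end

section \<open>Translating the walk by reversing two signs\<close>

definition often_near :: "(nat \<Rightarrow> real) \<Rightarrow> real \<Rightarrow> real \<Rightarrow> (nat \<Rightarrow> real) set" where
  "often_near a c r =
    {x \<in> space (PiM {1..} (\<lambda>_. borel)). \<exists>\<^sub>\<infinity>n. \<bar>(\<Sum>k=1..n. x k * a k) - c\<bar> < r}"

lemma often_near_measurable [measurable]:
  "often_near a c r \<in> sets (PiM {1..} (\<lambda>_. borel))"
proof -
  have [measurable]: "(\<lambda>x. \<Sum>k=1..n. x k * a k) \<in> borel_measurable (PiM {1..} (\<lambda>_. borel))" for n
    by (intro borel_measurable_sum borel_measurable_times measurable_component_singleton) auto
  show ?thesis
    unfolding often_near_def INFM_nat_le by measurable
qed

lemma flip_pair_walk: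
  fixes x a :: "nat \<Rightarrow> real"
  assumes "i \<noteq> j" "i \<in> {1..n}" "j \<in> {1..n}" "x i = 1" "x j = -1"
  shows "(\<Sum>k=1..n. flip {i, j} x k * a k) = (\<Sum>k=1..n. x k * a k) + 2 * (a j - a i)"
proof -
  have "(\<Sum>k=1..n. flip {i, j} x k * a k) - (\<Sum>k=1..n. x k * a k)
      = (\<Sum>k=1..n. flip {i, j} x k * a k - x k * a k)"
    by (simp add: sum_subtractf)
  also have "\<dots> = (\<Sum>k\<in>{i, j}. flip {i, j} x k * a k - x k * a k)"
    using assms by (intro sum.mono_neutral_right) (auto simp: flip_def)
  also have "\<dots> = 2 * (a j - a i)"
    using assms by (simp add: flip_def)
  finally show ?thesis by simp
qed

lemma flip_pair_often_near:
  assumes x: "x \<in> often_near a c r" and ij: "i \<noteq> j" "i \<ge> 1" "j \<ge> 1" "x i = 1" "x j = -1"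
    and close: "\<bar>2 * (a j - a i) - (q - c)\<bar> < r"
  shows "flip {i, j} x \<in> often_near a q (2 * r)"
proof -
  have "flip {i, j} x \<in> space (PiM {1..} (\<lambda>_. borel))"
    using x ij by (auto simp: often_near_def flip_def space_PiM PiE_def extensional_def)
  moreover have "\<exists>\<^sub>\<infinity>n. \<bar>(\<Sum>k=1..n. x k * a k) - c\<bar> < r"
    using x by (simp add: often_near_def)
  then have "\<exists>\<^sub>\<infinity>n. \<bar>(\<Sum>k=1..n. x k * a k) - c\<bar> < r \<and> max i j \<le> n"
    by (rule frequently_eventually_frequently)
       (auto simp: MOST_nat_le intro!: exI[of _ "max i j"])
  then have "\<exists>\<^sub>\<infinity>n. \<bar>(\<Sum>k=1..n. flip {i, j} x k * a k) - q\<bar> < 2 * r"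
  proof (rule frequently_elim1)
    fix n assume n: "\<bar>(\<Sum>k=1..n. x k * a k) - c\<bar> < r \<and> max i j \<le> n"
    then have "(\<Sum>k=1..n. flip {i, j} x k * a k) = (\<Sum>k=1..n. x k * a k) + 2 * (a j - a i)"
      using ij by (intro flip_pair_walk) auto
    then show "\<bar>(\<Sum>k=1..n. flip {i, j} x k * a k) - q\<bar> < 2 * r"
      using n close by linarith
  qed
  ultimately show ?thesis by (simp add: often_near_def)
qed

text \<open>
  Some \<open>F \<subseteq> {i, j}\<close> turns the signs at \<open>i\<close> and \<open>j\<close> into \<open>1\<close> and \<open>-1\<close>. If the reversed sequence still
  frequents the neighbourhood of \<open>c\<close>, then reversing both signs once more carries the visits over
  to the neighbourhood of \<open>q\<close>; in effect, the signs in \<open>{i, j} - F\<close> have been reversed.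
\<close>

lemma some_flip_escapes:
  fixes x :: "nat \<Rightarrow> real"
  assumes x: "x i \<in> {-1, 1}" "x j \<in> {-1, 1}"
    and ij: "i \<noteq> j" "i \<ge> 1" "j \<ge> 1"
    and close: "\<bar>2 * (a j - a i) - (q - c)\<bar> < r"
  shows "\<exists>F \<subseteq> {i, j}. flip F x \<notin> often_near a c r - often_near a q (2 * r)"
proof -
  define F where "F = (if x i = 1 then {} else {i}) \<union> (if x j = 1 then {j} else {})"
  define y where "y = flip F x"
  have y: "y i = 1" "y j = -1"
    using x ij(1) by (auto simp: y_def F_def flip_def)
  have F: "F \<subseteq> {i, j}" by (auto simp: F_def)
  show ?thesis
  proof (cases "y \<in> often_near a c r")
    case True
    then have "flip {i, j} y \<in> often_near a q (2 * r)"
      using ij y close by (intro flip_pair_often_near)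
    moreover have "flip {i, j} y = flip ({i, j} - F) x"
      using F by (auto simp: y_def flip_def fun_eq_iff)
    ultimately show ?thesis by (intro exI[of _ "{i, j} - F"]) auto
  next
    case False
    then show ?thesis using F unfolding y_def by blast
  qed
qed

section \<open>Differences of the coefficients\<close>

text \<open>
  Past a large index \<open>i\<close> the coefficients move in steps shorter than \<open>\<rho>\<close>. Being unbounded they
  climb from \<open>a i\<close> beyond \<open>a i + z\<close>, and they cannot jump over an interval of length \<open>\<rho>\<close>. A negative
  difference is obtained by exchanging \<open>i\<close> and \<open>j\<close>.
\<close>

lemma remote_differences_dense:
  fixes a :: "nat \<Rightarrow> real"
  assumes nonneg: "\<And>n. n \<ge> 1 \<Longrightarrow> a n \<ge> 0"
    and unbounded: "\<not> bounded (a ` {1..})"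
    and increments: "(\<lambda>n. a n - a (n - 1)) \<longlonglongrightarrow> 0"
    and "\<rho> > 0"
  shows "\<exists>i>N. \<exists>j>N. i \<noteq> j \<and> \<bar>a j - a i - y\<bar> < \<rho>"
proof -
  have upward: "\<exists>i>N. \<exists>j>i. \<bar>a j - a i - z\<bar> < \<rho>" if "z \<ge> 0" for z
  proof -
    obtain N' where N': "\<And>n. n \<ge> N' \<Longrightarrow> \<bar>a n - a (n - 1)\<bar> < \<rho>"
      using LIMSEQ_D[OF increments \<open>\<rho> > 0\<close>] by auto
    define i where "i = Suc (max N N')"
    have "\<exists>j>i. a j \<ge> a i + z"
    proof (rule ccontr)
      assume "\<not> ?thesis"
      then have "a k \<le> a i + z" if "k > i" for k
        using that by force
      moreover have "a k \<le> Max (a ` {1..i})" if "1 \<le> k" "k \<le> i" for k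
        using that by (intro Max_ge) auto
      ultimately have "\<bar>a k\<bar> \<le> max (a i + z) (Max (a ` {1..i}))" if "k \<ge> 1" for k
        using that nonneg[OF that] by (cases "k \<le> i") (auto simp: le_max_iff_disj)
      then have "bounded (a ` {1..})"
        by (auto simp: bounded_real)
      then show False using unbounded by simp
    qed
    \<comment> \<open>the first passage over the level \<open>a i + z\<close> overshoots it by less than one step\<close>
    define j where "j = (LEAST j. j > i \<and> a j \<ge> a i + z)"
    have j: "j > i \<and> a j \<ge> a i + z"
      unfolding j_def by (rule LeastI_ex) fact
    have "a (j - 1) \<le> a i + z"
    proof (cases "j - 1 = i")
      case True
      then show ?thesis using that by simp
    next
      case False
      have "\<not> (j - 1 > i \<and> a (j - 1) \<ge> a i + z)"
        using j not_less_Least[of "j - 1" "\<lambda>j. j > i \<and> a j \<ge> a i + z"]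
        unfolding j_def[symmetric] by simp
      then show ?thesis using False j by auto
    qed
    moreover have "\<bar>a j - a (j - 1)\<bar> < \<rho>"
      using j by (intro N') (auto simp: i_def)
    ultimately have "\<bar>a j - a i - z\<bar> < \<rho>" using j by linarith
    moreover have "i > N" by (simp add: i_def)
    ultimately show ?thesis using j by blast
  qed
  show ?thesis
  proof (cases "y \<ge> 0")
    case True
    then show ?thesis using upward[of y] by (metis less_trans nat_neq_iff)
  next
    case False
    then obtain i j where "i > N" "j > i" "\<bar>a j - a i - (- y)\<bar> < \<rho>" using upward[of "- y"] by auto
    then show ?thesis
      by (intro exI[of _ j] conjI exI[of _ i]) auto
  qed
qed

section \<open>Rademacher walks\<close>

lemma rademacher_AE:
  assumes "prob_space M" "rademacher_sequence M \<epsilon>" "n \<ge> 1"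
  shows "AE w in M. \<epsilon> n w \<in> {-1, 1}"
proof -
  interpret prob_space M by fact
  have [measurable]: "\<epsilon> n \<in> borel_measurable M"
    using assms by (auto simp: rademacher_sequence_def indep_vars_def)
  have "prob ({w \<in> space M. \<epsilon> n w = 1} \<union> {w \<in> space M. \<epsilon> n w = -1}) = 1"
    using assms by (subst finite_measure_Union) (auto simp: rademacher_sequence_def)
  from AE_prob_1[OF this] show ?thesis by eventually_elim auto
qed

lemma rademacher_symmetric:
  assumes "prob_space M" "rademacher_sequence M \<epsilon>" "n \<ge> 1"
  shows "distr M borel (\<lambda>w. - \<epsilon> n w) = distr M borel (\<epsilon> n)"
proof -
  interpret prob_space M by fact
  have [measurable]: "\<epsilon> n \<in> borel_measurable M"
    using assms by (auto simp: rademacher_sequence_def indep_vars_def)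
  have *: "prob {w \<in> space M. s * \<epsilon> n w \<in> S} = (indicator S 1 + indicator S (-1)) / 2"
    if [measurable]: "S \<in> sets borel" and s: "s \<in> {-1, 1}" for s :: real and S
  proof -
    let ?P = "\<lambda>v. {w \<in> space M. \<epsilon> n w = v}"
    have h: "prob (?P v) = 1 / 2" if "v \<in> {-1, 1}" for v
      using assms that by (auto simp: rademacher_sequence_def)
    have "prob {w \<in> space M. s * \<epsilon> n w \<in> S}
        = prob ({w \<in> ?P 1. s \<in> S} \<union> {w \<in> ?P (-1). - s \<in> S})"
      using rademacher_AE[OF assms] by (intro finite_measure_eq_AE) auto
    also have "\<dots> = prob {w \<in> ?P 1. s \<in> S} + prob {w \<in> ?P (-1). - s \<in> S}"
      by (rule finite_measure_Union) auto
    also have "\<dots> = (indicator S 1 + indicator S (-1)) / 2"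
      using s h[of 1] h[of "-1"] by (elim insertE emptyE) (simp_all add: indicator_def)
    finally show ?thesis .
  qed
  show ?thesis
  proof (rule measure_eqI)
    fix S :: "real set" assume "S \<in> sets (distr M borel (\<lambda>w. - \<epsilon> n w))"
    then have S [measurable]: "S \<in> sets borel" by simp
    have "prob ((\<lambda>w. - \<epsilon> n w) -` S \<inter> space M) = prob (\<epsilon> n -` S \<inter> space M)"
      using *[OF S, of 1] *[OF S, of "-1"] by (simp add: vimage_def Int_def conj_commute)
    then show "emeasure (distr M borel (\<lambda>w. - \<epsilon> n w)) S = emeasure (distr M borel (\<epsilon> n)) S"
      by (simp add: emeasure_distr emeasure_eq_measure)
  qed simp
qed

text \<open>
  The exceptional event \<open>E\<close> is covered, up to a null set, by the events that reversing \<open>F\<close> changes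
  membership in \<open>E\<close>, for the four sets \<open>F \<subseteq> {i, j}\<close>. All of them are improbable once \<open>i\<close> and \<open>j\<close> lie
  beyond the finite set of indices on which \<open>E\<close> essentially depends.
\<close>

lemma often_near_transfer:
  fixes \<epsilon> :: "nat \<Rightarrow> 'w \<Rightarrow> real" and a :: "nat \<Rightarrow> real"
  assumes M: "prob_space M" and \<epsilon>: "rademacher_sequence M \<epsilon>"
    and a: "\<And>n. n \<ge> 1 \<Longrightarrow> a n \<ge> 0" "\<not> bounded (a ` {1..})" "(\<lambda>n. a n - a (n - 1)) \<longlonglongrightarrow> 0"
    and "r > 0"
  shows "AE w in M. (\<exists>\<^sub>\<infinity>n. \<bar>rademacher_walk \<epsilon> a n w - c\<bar> < r) \<longrightarrow>
    (\<exists>\<^sub>\<infinity>n. \<bar>rademacher_walk \<epsilon> a n w - q\<bar> < 2 * r)"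
proof -
  interpret symmetric_family M "{1..}" \<epsilon>
    using M \<epsilon> rademacher_symmetric[OF M \<epsilon>]
    by (auto simp: symmetric_family_def symmetric_family_axioms_def rademacher_sequence_def)
  define E where "E = often_near a c r - often_near a q (2 * r)"
  have E [measurable]: "E \<in> sets (PiM {1..} (\<lambda>_. borel))"
    unfolding E_def by measurable
  have le: "prob {w \<in> space M. signs w \<in> E} \<le> 4 * \<eta>" if "\<eta> > 0" for \<eta>
  proof -
    obtain J where "finite J" and J: "\<And>F. F \<subseteq> {1..} - J \<Longrightarrow>
        prob {w \<in> space M. (signs w \<in> E) \<noteq> (flip F (signs w) \<in> E)} < \<eta>"
      using almost_invariant_under_remote_flips[OF E \<open>\<eta> > 0\<close>] by blast
    obtain N where N: "\<And>k. k \<in> J \<Longrightarrow> k \<le> N"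
      using \<open>finite J\<close> by (auto simp: finite_nat_set_iff_bounded_le)
    obtain i j where ij: "i > N" "j > N" "i \<noteq> j" "\<bar>a j - a i - (q - c) / 2\<bar> < r / 2"
      using remote_differences_dense[OF a, of "r / 2" N "(q - c) / 2"] \<open>r > 0\<close> by auto
    let ?D = "\<lambda>F. {w \<in> space M. (signs w \<in> E) \<noteq> (flip F (signs w) \<in> E)}"
    have sub: "F \<subseteq> {1..} - J" if "F \<in> Pow {i, j}" for F
      using that ij N by force
    have D: "?D F \<in> events" if "F \<in> Pow {i, j}" for F
    proof -
      have F: "F \<subseteq> {1..}" using sub[OF that] by auto
      note [measurable] = flip_measurable[OF F]
      show ?thesis by measurable
    qed
    have ae: "AE w in M. \<epsilon> i w \<in> {-1, 1}" "AE w in M. \<epsilon> j w \<in> {-1, 1}"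
      using ij by (intro rademacher_AE[OF M \<epsilon>]; linarith)+
    have "AE w in M. signs w \<in> E \<longrightarrow> w \<in> (\<Union>F\<in>Pow {i, j}. ?D F)"
      using ae AE_space
    proof eventually_elim
      fix w assume w: "\<epsilon> i w \<in> {-1, 1}" "\<epsilon> j w \<in> {-1, 1}" "w \<in> space M"
      have "\<exists>F \<subseteq> {i, j}. flip F (signs w) \<notin> E"
        unfolding E_def using w ij signs_component[of i w] signs_component[of j w]
        by (intro some_flip_escapes) (simp_all del: One_nat_def add: abs_less_iff field_simps)
      then show "signs w \<in> E \<longrightarrow> w \<in> (\<Union>F\<in>Pow {i, j}. ?D F)"
        using w by blast
    qed
    then have "prob {w \<in> space M. signs w \<in> E} \<le> prob (\<Union>F\<in>Pow {i, j}. ?D F)"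
      using D by (intro finite_measure_mono_AE sets.finite_UN) auto
    also have "\<dots> \<le> (\<Sum>F\<in>Pow {i, j}. prob (?D F))"
      using D by (intro finite_measure_subadditive_finite) auto
    also have "\<dots> \<le> (\<Sum>F\<in>Pow {i, j}. \<eta>)"
    proof (rule sum_mono)
      fix F assume "F \<in> Pow {i, j}"
      from J[OF sub[OF this]] show "prob (?D F) \<le> \<eta>" by (rule less_imp_le)
    qed
    also have "\<dots> = 4 * \<eta>"
      using ij by (simp add: card_Pow)
    finally show ?thesis .
  qed
  have "prob {w \<in> space M. signs w \<in> E} \<le> 0"
    by (rule field_le_epsilon) (use le[of "e / 4" for e] in auto)
  then have "prob {w \<in> space M. signs w \<in> E} = 0"
    using measure_nonneg antisym by blast
  then have "AE w in M. signs w \<notin> E"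
    by (subst (asm) prob_eq_0) measurable
  moreover have "signs w \<in> often_near a v s \<longleftrightarrow> (\<exists>\<^sub>\<infinity>n. \<bar>rademacher_walk \<epsilon> a n w - v\<bar> < s)" for w v s
  proof -
    have "(\<Sum>k=1..n. signs w k * a k) = rademacher_walk \<epsilon> a n w" for n
      using signs_component[of _ w] by (simp add: rademacher_walk_def del: One_nat_def)
    then show ?thesis
      using signs_in[of w] by (simp add: often_near_def space_PiM del: One_nat_def)
  qed
  ultimately show ?thesis by (auto simp: E_def)
qed

section \<open>Recurrence implies density\<close>

lemma bounded_often_imp_often_near_rat:
  fixes x :: "nat \<Rightarrow> real"
  assumes often: "\<exists>\<^sub>\<infinity>n. \<bar>x n\<bar> \<le> C" and "r > 0"
  shows "\<exists>c\<in>\<rat>. \<exists>\<^sub>\<infinity>n. \<bar>x n - c\<bar> < r"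
proof -
  have "{n. \<bar>x n\<bar> \<le> C} \<subseteq> {n. x n \<in> {-C..C}}" by auto
  then obtain s :: "nat \<Rightarrow> nat" where s: "strict_mono s" "\<And>n. x (s n) \<in> {-C..C}"
    using often unfolding frequently_cofinite
    by (metis (mono_tags, lifting) infinite_enumerate infinite_super mem_Collect_eq)
  obtain l t where t: "strict_mono t" "((x \<circ> s) \<circ> t) \<longlonglongrightarrow> l"
    using compact_Icc[of "-C" C] s(2) unfolding compact_def by (metis comp_apply)
  obtain c where c: "c \<in> \<rat>" "l - r < c" "c < l"
    using Rats_dense_in_real[of "l - r" l] \<open>r > 0\<close> by auto
  have "\<forall>\<^sub>F n in sequentially. x (s (t n)) \<in> {c - r<..<c + r}"
    using c by (intro topological_tendstoD[OF t(2)[unfolded comp_def]]) auto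
  then obtain n0 where n0: "\<And>n. n \<ge> n0 \<Longrightarrow> \<bar>x (s (t n)) - c\<bar> < r"
    by (auto simp: eventually_sequentially abs_diff_less_iff)
  have "\<exists>\<^sub>\<infinity>n. \<bar>x n - c\<bar> < r"
    unfolding INFM_nat_le
  proof
    fix m
    have "max m n0 \<le> s (t (max m n0))"
      by (rule le_trans[OF seq_suble[OF t(1)] seq_suble[OF s(1)]])
    then show "\<exists>n\<ge>m. \<bar>x n - c\<bar> < r"
      using n0[of "max m n0"] by (intro exI[of _ "s (t (max m n0))"]) auto
  qed
  then show ?thesis using c by blast
qed

theorem theorem13:
  fixes M :: "'w measure" and \<epsilon> :: "nat \<Rightarrow> 'w \<Rightarrow> real" and a :: "nat \<Rightarrow> real"
  assumes "prob_space M"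
    and "rademacher_sequence M \<epsilon>"
    and "\<And>n. n \<ge> 1 \<Longrightarrow> a n \<ge> 0"
    and "\<not> bounded (a ` {1..})"
    and "(\<lambda>n. a n - a (n - 1)) \<longlonglongrightarrow> 0"
  shows "transient M (rademacher_walk \<epsilon> a) \<or> topologically_recurrent M (rademacher_walk \<epsilon> a)"
proof (cases "weakly_recurrent M (rademacher_walk \<epsilon> a)")
  case False
  then show ?thesis by (simp add: transient_def)
next
  case True
  interpret prob_space M by fact
  let ?X = "rademacher_walk \<epsilon> a"
  have "AE w in M. \<exists>C. \<exists>\<^sub>\<infinity>n. \<bar>?X n w\<bar> \<le> C"
    using AE_prob_1[OF True[unfolded weakly_recurrent_def]] by eventually_elim auto
  moreover have "AE w in M. \<forall>c\<in>\<rat>. \<forall>q\<in>\<rat>. \<forall>r\<in>\<rat> \<inter> {0<..}.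
      (\<exists>\<^sub>\<infinity>n. \<bar>?X n w - c\<bar> < r) \<longrightarrow> (\<exists>\<^sub>\<infinity>n. \<bar>?X n w - q\<bar> < 2 * r)"
    using often_near_transfer[OF assms]
    by (intro AE_ball_countable' countable_rat countable_Int1) auto
  ultimately have "AE w in M. closure (range (\<lambda>n. ?X n w)) = UNIV"
  proof eventually_elim
    fix w
    assume "\<exists>C. \<exists>\<^sub>\<infinity>n. \<bar>?X n w\<bar> \<le> C"
      and shift: "\<forall>c\<in>\<rat>. \<forall>q\<in>\<rat>. \<forall>r\<in>\<rat> \<inter> {0<..}.
      (\<exists>\<^sub>\<infinity>n. \<bar>?X n w - c\<bar> < r) \<longrightarrow> (\<exists>\<^sub>\<infinity>n. \<bar>?X n w - q\<bar> < 2 * r)"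
    then obtain C where C: "\<exists>\<^sub>\<infinity>n. \<bar>?X n w\<bar> \<le> C" by blast
    have "v \<in> closure (range (\<lambda>n. ?X n w))" for v
      unfolding closure_approachable
    proof (intro allI impI)
      fix e :: real assume "e > 0"
      obtain r where r: "r \<in> \<rat>" "0 < r" "r < e / 3"
        using Rats_dense_in_real[of 0 "e / 3"] \<open>e > 0\<close> by auto
      obtain q where q: "q \<in> \<rat>" "v < q" "q < v + e / 3"
        using Rats_dense_in_real[of v "v + e / 3"] \<open>e > 0\<close> by auto
      obtain c where "c \<in> \<rat>" "\<exists>\<^sub>\<infinity>n. \<bar>?X n w - c\<bar> < r"
        using bounded_often_imp_often_near_rat[OF C r(2)] by blast
      then have "\<exists>\<^sub>\<infinity>n. \<bar>?X n w - q\<bar> < 2 * r"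
        using shift q r by blast
      then obtain n where "\<bar>?X n w - q\<bar> < 2 * r"
        using frequently_ex by blast
      then show "\<exists>y\<in>range (\<lambda>n. ?X n w). dist y v < e"
        using r q by (intro bexI[of _ "?X n w"]) (auto simp: dist_real_def)
    qed
    then show "closure (range (\<lambda>n. ?X n w)) = UNIV" by blast
  qed
  then show ?thesis by (simp add: topologically_recurrent_def)
qed

end
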